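(* Fix an orthonormal basis $B$ of $\mathbb{C}^2$ and a parameter $t\in(0,1)\setminus\{\tfrac12\}$. There exist qubit states $\rho,\sigma$ such that for the pinching (dephasing) channel $\Pi_B$, $$\mathsf{F}_t^{\mathrm{spec}}\big(\Pi_B(\rho),\Pi_B(\sigma)\big)\;<\;\mathsf{F}_t^{\mathrm{spec}}(\rho,\sigma).$$ Moreover, one can choose $\rho,\sigma$ arbitrarily close to a commuting pair, i.e. with arbitrarily small off-diagonal coherences in the basis $B$: for every $\varepsilon>0$ there are such qubit states $\rho,\sigma$ satisfying the strict inequality whose off-diagonal entries in the basis $B$ all have modulus less than $\varepsilon$.
   Context: A qubit state is a positive semidefinite complex $2\times2$ matrix of trace one. The pinching channel $\Pi_B$ in an orthonormal basis $B$ keeps the diagonal entries of a matrix written in the basis $B$ and sets the off-diagonal entries to zero. For positive definite $A,B'$, the matrix geometric mean is $A\sharp B'=A^{1/2}(A^{-1/2}B'A^{-1/2})^{1/2}A^{1/2}$, and the weighted spectral fidelity is $\mathsf{F}_t^{\mathrm{spec}}(\rho,\sigma)=\operatorname{Tr}\big(\rho\,(\rho^{-1}\sharp\sigma)^{2t}\big)$ for $t\in[0,1]$. Explicitly $\rho^{-1}\sharp\sigma=\rho^{-1/2}(\rho^{1/2}\sigma\rho^{1/2})^{1/2}\rho^{-1/2}$; for singular states this formula is used with inverse and fractional powers interpreted on the support of the corresponding operator (zero on its kernel). *)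

theory Defs
  imports "HOL-Analysis.Analysis"
begin

section \<open>Complex matrices\<close>

definition adj :: "complex^'n^'m \<Rightarrow> complex^'m^'n" where
  "adj A = (\<chi> i j. cnj (A $ j $ i))"

text \<open>The library's inner product on \<^typ>\<open>complex^'n\<close> is the underlying real one; this is the
  complex one, antilinear in the first argument.\<close>

definition cdot :: "complex^'n \<Rightarrow> complex^'n \<Rightarrow> complex" where
  "cdot u v = (\<Sum>i\<in>UNIV. cnj (u $ i) * v $ i)"

definition hermitian :: "complex^'n^'n \<Rightarrow> bool" where
  "hermitian A \<longleftrightarrow> adj A = A"

definition unitary :: "complex^'n^'n \<Rightarrow> bool" where
  "unitary U \<longleftrightarrow> adj U ** U = mat 1 \<and> U ** adj U = mat 1"

definition diag :: "('n \<Rightarrow> complex) \<Rightarrow> complex^'n^'n" where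
  "diag d = (\<chi> i j. if i = j then d i else 0)"

definition pos_semidef :: "complex^'n^'n \<Rightarrow> bool" where
  "pos_semidef A \<longleftrightarrow> hermitian A \<and> (\<forall>v. 0 \<le> Re (cdot v (A *v v)))"

definition pos_def :: "complex^'n^'n \<Rightarrow> bool" where
  "pos_def A \<longleftrightarrow> hermitian A \<and> (\<forall>v. v \<noteq> 0 \<longrightarrow> 0 < Re (cdot v (A *v v)))"

text \<open>Real powers of a positive semidefinite matrix by functional calculus. Since
  \<^term>\<open>0 powr r = (0::real)\<close> for every exponent, including negative ones, \<open>mpow A r\<close> is the power
  taken on the support of \<open>A\<close> and is zero on the kernel of \<open>A\<close>. The matrix
  \<open>X\<close> does not depend on the diagonalization, see \<open>mpow_eq\<close> and \<open>hermitian_diag\<close> below.\<close>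

definition mpow :: "complex^'n^'n \<Rightarrow> real \<Rightarrow> complex^'n^'n" where
  "mpow A r = (THE X. \<exists>U (d :: 'n \<Rightarrow> real). unitary U \<and>
      A = U ** diag (\<lambda>i. of_real (d i)) ** adj U \<and>
      X = U ** diag (\<lambda>i. of_real (d i powr r)) ** adj U)"


section \<open>Qubit states, pinching and spectral fidelity\<close>

definition qubit_state :: "complex^2^2 \<Rightarrow> bool" where
  "qubit_state \<rho> \<longleftrightarrow> pos_semidef \<rho> \<and> trace \<rho> = 1"

text \<open>A basis is an indexed family; orthonormal families indexed by \<open>'n\<close> automatically span
  \<^typ>\<open>complex^'n\<close>.\<close>

definition orthonormal_basis :: "('n \<Rightarrow> complex^'n) \<Rightarrow> bool" where
  "orthonormal_basis B \<longleftrightarrow> (\<forall>i j. cdot (B i) (B j) = (if i = j then 1 else 0))"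

text \<open>The matrix with columns \<open>B i\<close>.\<close>

definition basis_matrix :: "('n \<Rightarrow> complex^'n) \<Rightarrow> complex^'n^'n" where
  "basis_matrix B = (\<chi> i j. B j $ i)"

text \<open>The matrix of \<open>A\<close> written in the orthonormal basis \<open>B\<close>; its entry \<open>(i, j)\<close> is
  \<open>cdot (B i) (A *v B j)\<close>.\<close>

definition in_basis :: "('n \<Rightarrow> complex^'n) \<Rightarrow> complex^'n^'n \<Rightarrow> complex^'n^'n" where
  "in_basis B A = adj (basis_matrix B) ** A ** basis_matrix B"

definition pinching :: "('n \<Rightarrow> complex^'n) \<Rightarrow> complex^'n^'n \<Rightarrow> complex^'n^'n" where
  "pinching B A = basis_matrix B ** diag (\<lambda>i. in_basis B A $ i $ i) ** adj (basis_matrix B)"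

definition geom_mean :: "complex^'n^'n \<Rightarrow> complex^'n^'n \<Rightarrow> complex^'n^'n" where
  "geom_mean A B =
     mpow A (1/2) ** mpow (mpow A (-1/2) ** B ** mpow A (-1/2)) (1/2) ** mpow A (1/2)"

text \<open>The explicit formula for the geometric mean of the inverse of \<open>\<rho>\<close> with \<open>\<sigma>\<close>, which also covers
  singular states; see \<open>spec_mean_eq_geom_mean\<close> below for the positive definite case.\<close>

definition spec_mean :: "complex^'n^'n \<Rightarrow> complex^'n^'n \<Rightarrow> complex^'n^'n" where
  "spec_mean \<rho> \<sigma> =
     mpow \<rho> (-1/2) ** mpow (mpow \<rho> (1/2) ** \<sigma> ** mpow \<rho> (1/2)) (1/2) ** mpow \<rho> (-1/2)"

text \<open>Taking the real part discards nothing for qubit states, see \<open>of_real_spec_fidelity\<close> below.\<close>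

definition spec_fidelity :: "real \<Rightarrow> complex^'n^'n \<Rightarrow> complex^'n^'n \<Rightarrow> real" where
  "spec_fidelity t \<rho> \<sigma> = Re (trace (\<rho> ** mpow (spec_mean \<rho> \<sigma>) (2 * t)))"


section \<open>Well-definedness\<close>

lemma adj_mult: "adj (A ** B) = adj B ** adj A"
  by (simp add: adj_def matrix_matrix_mult_def vec_eq_iff mult.commute)

lemma adj_adj [simp]: "adj (adj A) = A"
  by (simp add: adj_def vec_eq_iff)

lemma diag_mult_left: "(diag d ** A) $ i $ j = d i * A $ i $ j"
  by (simp add: diag_def matrix_matrix_mult_def mult_delta_left)

lemma diag_mult_right: "(A ** diag d) $ i $ j = A $ i $ j * d j"
  by (simp add: diag_def matrix_matrix_mult_def mult_delta_right)

lemma diag_fun_unique: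
  fixes U V :: "complex^'n^'n" and d e :: "'n \<Rightarrow> real"
  assumes U: "unitary U" and V: "unitary V"
    and eq: "U ** diag (\<lambda>i. of_real (d i)) ** adj U = V ** diag (\<lambda>i. of_real (e i)) ** adj V"
  shows "U ** diag (\<lambda>i. of_real (f (d i))) ** adj U = V ** diag (\<lambda>i. of_real (f (e i))) ** adj V"
proof -
  define W where "W = adj V ** U"
  have swap: "W ** D = E ** W \<longleftrightarrow> U ** D ** adj U = V ** E ** adj V" for D E
  proof
    assume "W ** D = E ** W"
    then have "V ** (W ** D) ** adj U = V ** (E ** W) ** adj U" by simp
    moreover have "V ** (W ** D) ** adj U = (V ** adj V) ** U ** D ** adj U"
      by (simp add: W_def matrix_mul_assoc)
    moreover have "V ** (E ** W) ** adj U = V ** E ** adj V ** (U ** adj U)"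
      by (simp add: W_def matrix_mul_assoc)
    ultimately show "U ** D ** adj U = V ** E ** adj V"
      using U V by (simp add: unitary_def)
  next
    assume "U ** D ** adj U = V ** E ** adj V"
    then have "adj V ** (U ** D ** adj U) ** U = adj V ** (V ** E ** adj V) ** U" by simp
    moreover have "adj V ** (U ** D ** adj U) ** U = W ** D ** (adj U ** U)"
      by (simp add: W_def matrix_mul_assoc)
    moreover have "adj V ** (V ** E ** adj V) ** U = (adj V ** V) ** E ** W"
      by (simp add: W_def matrix_mul_assoc)
    ultimately show "W ** D = E ** W"
      using U V by (simp add: unitary_def)
  qed
  have "W ** diag (\<lambda>i. of_real (d i)) = diag (\<lambda>i. of_real (e i)) ** W"
    using eq swap by blast
  then have *: "W $ i $ j * of_real (d j) = of_real (e i) * W $ i $ j" for i j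
    by (metis diag_mult_left diag_mult_right)
  have "W $ i $ j * of_real (f (d j)) = of_real (f (e i)) * W $ i $ j" for i j
    using *[of i j] by (cases "W $ i $ j = 0") (auto simp: mult.commute)
  then have "W ** diag (\<lambda>i. of_real (f (d i))) = diag (\<lambda>i. of_real (f (e i))) ** W"
    by (simp add: vec_eq_iff diag_mult_left diag_mult_right)
  then show ?thesis using swap by blast
qed

lemma mpow_eq:
  fixes U :: "complex^'n^'n" and d :: "'n \<Rightarrow> real"
  assumes "unitary U" "A = U ** diag (\<lambda>i. of_real (d i)) ** adj U"
  shows "mpow A r = U ** diag (\<lambda>i. of_real (d i powr r)) ** adj U"
  unfolding mpow_def
proof (rule the_equality)
  show "\<exists>V (e :: 'n \<Rightarrow> real). unitary V \<and>
      A = V ** diag (\<lambda>i. of_real (e i)) ** adj V \<and>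
      U ** diag (\<lambda>i. of_real (d i powr r)) ** adj U = V ** diag (\<lambda>i. of_real (e i powr r)) ** adj V"
    using assms by blast
next
  fix X
  assume "\<exists>V (e :: 'n \<Rightarrow> real). unitary V \<and>
      A = V ** diag (\<lambda>i. of_real (e i)) ** adj V \<and>
      X = V ** diag (\<lambda>i. of_real (e i powr r)) ** adj V"
  then show "X = U ** diag (\<lambda>i. of_real (d i powr r)) ** adj U"
    using assms diag_fun_unique[where f = "\<lambda>x. x powr r"] by metis
qed

lemma hermitian_diag:
  fixes A :: "complex^2^2"
  assumes "hermitian A"
  obtains U and d :: "2 \<Rightarrow> real" where "unitary U" "A = U ** diag (\<lambda>i. of_real (d i)) ** adj U"
proof -
  have A: "cnj (A $ j $ i) = A $ i $ j" for i j
    using assms unfolding hermitian_def adj_def vec_eq_iff by simp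
  define a where "a = Re (A $ 1 $ 1)"
  define c where "c = Re (A $ 2 $ 2)"
  define b where "b = A $ 1 $ 2"
  have e11: "A $ 1 $ 1 = of_real a" and e22: "A $ 2 $ 2 = of_real c"
    using A[of 1 1] A[of 2 2] by (auto simp: a_def c_def complex_eq_iff)
  have e12: "A $ 1 $ 2 = b" and e21: "A $ 2 $ 1 = cnj b"
    using A[of 1 2] A[of 2 1] by (auto simp: b_def)
  show thesis
  proof (cases "b = 0")
    case True
    show thesis
    proof (rule that[of "mat 1" "\<lambda>i. if i = 1 then a else c"])
      show "unitary (mat 1 :: complex^2^2)"
        by (simp add: unitary_def adj_def mat_def matrix_matrix_mult_def vec_eq_iff forall_2 sum_2)
      show "A = mat 1 ** diag (\<lambda>i. of_real (if i = 1 then a else c)) ** adj (mat 1)"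
        using True
        by (simp add: e11 e22 e12 e21 diag_def adj_def mat_def matrix_matrix_mult_def vec_eq_iff
            forall_2 sum_2)
    qed
  next
    case False
    define k where "k = (c - a) / 2 + sqrt (((a - c) / 2)\<^sup>2 + (cmod b)\<^sup>2)"
    define N where "N = (cmod b)\<^sup>2 + k\<^sup>2"
    define n where "n = complex_of_real (1 / sqrt N)"
    have "(k - (c - a) / 2)\<^sup>2 = ((a - c) / 2)\<^sup>2 + (cmod b)\<^sup>2"
      by (simp add: k_def)
    then have k: "k * (k + a - c) = (cmod b)\<^sup>2"
      by (simp add: power2_eq_square field_simps)
    have "N > 0" using False by (simp add: N_def add_pos_nonneg)
    have bb: "b * cnj b = of_real (k * (k + a - c))"
      using complex_norm_square[of b] k by simp
    have nN: "n * n * of_real N = 1"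
      using \<open>N > 0\<close> by (simp add: n_def flip: of_real_mult)
    have NN: "of_real N = b * cnj b + of_real k * of_real k"
      using complex_norm_square[of b] by (simp add: N_def power2_eq_square)
    have nn: "n * n * (b * cnj b + of_real k * of_real k) = 1"
      using nN NN by simp
    have cn: "cnj n = n" by (simp add: n_def)
    define U :: "complex^2^2" where
      "U = (\<chi> i j. n * (if j = 1 then if i = 1 then b else of_real k
                       else if i = 1 then - of_real k else cnj b))"
    have "U ** adj U = mat 1"
      using nn
      by (simp add: U_def adj_def mat_def matrix_matrix_mult_def vec_eq_iff forall_2 sum_2 cn
          algebra_simps)
    moreover from this have "adj U ** U = mat 1"
      by (simp add: matrix_left_right_inverse)
    ultimately have U: "unitary U"
      by (simp add: unitary_def)
    define D :: "complex^2^2" where "D = diag (\<lambda>i. of_real (if i = 1 then a + k else c - k))"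
    have key1: "cnj b * b + of_real c * of_real k = of_real k * (of_real a + of_real k)"
      and key2: "b * cnj b - of_real a * of_real k = - of_real k * (of_real c - of_real k)"
      using bb by (simp_all add: algebra_simps)
    have "(A ** U) $ 1 $ 1 = n * b * (of_real a + of_real k)"
      by (simp add: U_def matrix_matrix_mult_def sum_2 e11 e12 algebra_simps)
    moreover have "(A ** U) $ 2 $ 1 = n * (cnj b * b + of_real c * of_real k)"
      by (simp add: U_def matrix_matrix_mult_def sum_2 e21 e22 algebra_simps)
    moreover have "(A ** U) $ 1 $ 2 = n * (b * cnj b - of_real a * of_real k)"
      by (simp add: U_def matrix_matrix_mult_def sum_2 e11 e12 algebra_simps)
    moreover have "(A ** U) $ 2 $ 2 = n * cnj b * (of_real c - of_real k)"
      by (simp add: U_def matrix_matrix_mult_def sum_2 e21 e22 algebra_simps)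
    ultimately have "A ** U = U ** D"
      unfolding D_def vec_eq_iff diag_mult_right key1 key2 by (simp add: forall_2 U_def)
    then have "A ** U ** adj U = U ** D ** adj U" by simp
    then have "A = U ** D ** adj U"
      using U by (simp add: unitary_def flip: matrix_mul_assoc)
    with U show thesis unfolding D_def by (rule that)
  qed
qed

lemma hermitian_conj_diag: "hermitian (U ** diag (\<lambda>i. of_real (d i)) ** adj U)"
proof -
  have "adj (diag (\<lambda>i. of_real (d i))) = diag (\<lambda>i. complex_of_real (d i))"
    by (auto simp: adj_def diag_def vec_eq_iff)
  then show ?thesis by (simp add: hermitian_def adj_mult matrix_mul_assoc)
qed

lemma hermitian_mpow: "hermitian (A :: complex^2^2) \<Longrightarrow> hermitian (mpow A r)"
  by (erule hermitian_diag) (simp add: mpow_eq[OF _ refl] hermitian_conj_diag)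

lemma hermitian_sandwich: "hermitian A \<Longrightarrow> hermitian B \<Longrightarrow> hermitian (A ** B ** A)"
  by (simp add: hermitian_def adj_mult matrix_mul_assoc)

lemma of_real_spec_fidelity:
  assumes "qubit_state \<rho>" "qubit_state \<sigma>"
  shows "of_real (spec_fidelity t \<rho> \<sigma>) = trace (\<rho> ** mpow (spec_mean \<rho> \<sigma>) (2 * t))"
proof -
  have h: "hermitian \<rho>" "hermitian \<sigma>"
    using assms by (auto simp: qubit_state_def pos_semidef_def)
  define X where "X = mpow (spec_mean \<rho> \<sigma>) (2 * t)"
  have X: "hermitian X"
    unfolding X_def spec_mean_def using h by (intro hermitian_mpow hermitian_sandwich)
  have "cnj (trace (\<rho> ** X)) = trace (adj (\<rho> ** X))"
    by (simp add: trace_def adj_def)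
  also have "\<dots> = trace (X ** \<rho>)"
    using h X by (simp add: adj_mult hermitian_def)
  also have "\<dots> = trace (\<rho> ** X)"
    by (rule trace_mul_sym)
  finally have "trace (\<rho> ** X) \<in> \<real>"
    by (simp add: Reals_cnj_iff)
  then show ?thesis
    unfolding spec_fidelity_def X_def by (rule of_real_Re)
qed

lemma diag_mult: "diag d ** diag e = diag (\<lambda>i. d i * e i)"
  unfolding vec_eq_iff diag_mult_left by (simp add: diag_def)

lemma spec_mean_eq_geom_mean:
  fixes \<rho> \<sigma> :: "complex^2^2"
  assumes "pos_def \<rho>"
  shows "spec_mean \<rho> \<sigma> = geom_mean (matrix_inv \<rho>) \<sigma>"
proof -
  obtain U and d :: "2 \<Rightarrow> real"
    where U: "unitary U" and \<rho>: "\<rho> = U ** diag (\<lambda>i. of_real (d i)) ** adj U"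
    using assms hermitian_diag unfolding pos_def_def by metis
  have UU: "adj U ** U = mat 1" "U ** adj U = mat 1" using U by (auto simp: unitary_def)
  have d: "d i > 0" for i
  proof -
    define v where "v = U *v axis i 1"
    have v: "adj U *v v = axis i 1"
      by (simp add: v_def matrix_vector_mul_assoc UU)
    then have "v \<noteq> 0" by (metis axis_eq_0_iff matrix_vector_mult_0_right zero_neq_one)
    have "\<rho> *v v = U *v (diag (\<lambda>i. of_real (d i)) *v axis i 1)"
      by (simp add: \<rho> v flip: matrix_vector_mul_assoc)
    also have "diag (\<lambda>i. of_real (d i)) *v axis i 1 = complex_of_real (d i) *s axis i 1"
      by (simp add: vec_eq_iff diag_def matrix_vector_mult_def axis_def forall_2 sum_2)
    also have "U *v (complex_of_real (d i) *s axis i 1) = complex_of_real (d i) *s v"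
      by (simp add: v_def vector_scalar_commute)
    finally have *: "cdot v (\<rho> *v v) = of_real (d i) * cdot v v"
      by (simp add: cdot_def sum_distrib_left ac_simps)
    have "cdot v v = of_real (\<Sum>i\<in>UNIV. (cmod (v $ i))\<^sup>2)"
      by (simp add: cdot_def complex_norm_square mult.commute del: of_real_power)
    then have "Re (cdot v (\<rho> *v v)) = d i * (\<Sum>i\<in>UNIV. (cmod (v $ i))\<^sup>2)"
      unfolding * by simp
    moreover have "Re (cdot v (\<rho> *v v)) > 0"
      using assms \<open>v \<noteq> 0\<close> by (simp add: pos_def_def)
    moreover have "(\<Sum>i\<in>UNIV. (cmod (v $ i))\<^sup>2) \<ge> 0"
      by (simp add: sum_nonneg)
    ultimately show ?thesis
      by (simp add: zero_less_mult_iff)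
  qed
  let ?R = "U ** diag (\<lambda>i. of_real (1 / d i)) ** adj U"
  have prod: "(U ** D ** adj U) ** (U ** E ** adj U) = U ** (D ** E) ** adj U" for D E
  proof -
    have "(U ** D ** adj U) ** (U ** E ** adj U) = U ** D ** (adj U ** U) ** E ** adj U"
      by (simp add: matrix_mul_assoc)
    then show ?thesis by (simp add: UU matrix_mul_assoc)
  qed
  have one: "diag (\<lambda>i. 1) = (mat 1 :: complex^2^2)" by (simp add: diag_def mat_def)
  have R: "\<rho> ** ?R = mat 1" "?R ** \<rho> = mat 1"
    using d unfolding \<rho> prod by (simp_all add: diag_mult one less_imp_neq[symmetric] UU)
  have "\<rho> ** matrix_inv \<rho> = mat 1 \<and> matrix_inv \<rho> ** \<rho> = mat 1"
    unfolding matrix_inv_def by (rule someI[where x = ?R]) (use R in blast)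
  then have inv: "matrix_inv \<rho> = ?R"
    using R(1) by (metis matrix_mul_assoc matrix_mul_lid matrix_mul_rid)
  have pw: "mpow (matrix_inv \<rho>) r = mpow \<rho> (- r)" for r
    unfolding inv mpow_eq[OF U refl] mpow_eq[OF U \<rho>]
    using d by (simp add: powr_minus powr_divide less_imp_le inverse_eq_divide)
  show ?thesis
    unfolding spec_mean_def geom_mean_def pw by simp
qed

end

theory Submission
  imports Defs
begin

text \<open>
  The violation is already visible for a pure state \<open>P\<close> and a state \<open>D\<close> diagonal in the basis \<open>B\<close>.
  If one of the two arguments is pure, the spectral mean is a multiple of the pure state, so the
  fidelity depends only on the overlap \<open>l = Tr (P D)\<close>: it is \<open>l powr t\<close> when the first argument is
  pure (\<open>spec_fidelity_pure_left\<close>) and \<open>l powr (1 - t)\<close> when the second one is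
  (\<open>spec_fidelity_pure_right\<close>). Pinching turns the pair into a commuting one, for which the
  fidelity is the classical sum of \<open>r i powr (1 - t) * s i powr t\<close> (\<open>spec_fidelity_commuting\<close>).

  Let \<open>P\<close> have the populations \<open>p\<close> and \<open>1 - p\<close> in the basis \<open>B\<close>. If \<open>D\<close> were the first basis
  projection, the overlap would be \<open>p\<close>. With \<open>P\<close> as the first argument, the fidelity would be
  \<open>p powr t\<close> before and \<open>p powr (1 - t)\<close> after the pinching, a strict decrease exactly for
  \<open>t < 1/2\<close>. With \<open>P\<close> as the second argument the two exponents are exchanged, which gives a
  decrease for \<open>t > 1/2\<close>. The value of the second case presupposes a nonsingular first argument,
  so \<open>D\<close> gets a small weight \<open>x\<close> on the other basis vector; since the inequality is strict and
  everything is continuous at \<open>x = 0\<close>, it survives (\<open>ex_mixing_weight\<close>). The only coherence in the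
  pair is that of \<open>P\<close>, of modulus \<open>sqrt (p * (1 - p))\<close>, and \<open>p\<close> may be taken as close to 1 as
  desired.
\<close>

section \<open>Matrix algebra\<close>

lemma matrix_mult_scaleR_left: "(c *\<^sub>R A) ** (B :: complex^'n^'n) = c *\<^sub>R (A ** B)"
  by (simp add: matrix_matrix_mult_def vec_eq_iff scaleR_sum_right)

lemma matrix_mult_scaleR_right: "A ** (c *\<^sub>R B :: complex^'n^'n) = c *\<^sub>R (A ** B)"
  by (simp add: matrix_matrix_mult_def vec_eq_iff scaleR_sum_right)

lemma trace_scaleR: "trace (c *\<^sub>R A) = c *\<^sub>R trace (A :: complex^'n^'n)"
  by (simp add: trace_def scaleR_sum_right)

lemma adj_scaleR: "adj (c *\<^sub>R A) = c *\<^sub>R adj A"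
  by (simp add: adj_def vec_eq_iff)

lemma scaleR_diag: "c *\<^sub>R diag (\<lambda>i. of_real (d i)) = diag (\<lambda>i. of_real (c * d i))"
  by (simp add: diag_def vec_eq_iff) (simp add: scaleR_conv_of_real)

lemma unitary_conj_mult:
  assumes "unitary U"
  shows "(U ** A ** adj U) ** (U ** B ** adj U) = U ** (A ** B) ** adj U"
proof -
  have "(U ** A ** adj U) ** (U ** B ** adj U) = U ** A ** (adj U ** U) ** B ** adj U"
    by (simp only: matrix_mul_assoc)
  also have "adj U ** U = mat 1"
    using assms by (simp add: unitary_def)
  finally show ?thesis
    by (simp add: matrix_mul_assoc)
qed

lemma unitary_conj_cancel:
  assumes "unitary U"
  shows "adj U ** (U ** A ** adj U) ** U = A"
proof -
  have "adj U ** (U ** A ** adj U) ** U = (adj U ** U) ** A ** (adj U ** U)"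
    by (simp add: matrix_mul_assoc)
  then show ?thesis
    using assms by (simp add: unitary_def)
qed

lemma trace_unitary_conj:
  assumes "unitary U"
  shows "trace (U ** A ** adj U) = trace A"
proof -
  have "trace (U ** A ** adj U) = trace (adj U ** (U ** A))"
    by (rule trace_mul_sym)
  then show ?thesis
    using assms by (simp add: unitary_def matrix_mul_assoc)
qed

lemma cdot_adj: "cdot v (A *v w) = cdot (adj A *v v) w"
  unfolding cdot_def adj_def matrix_vector_mult_def
  by (simp add: sum_distrib_left sum_distrib_right mult_ac) (rule sum.swap)

section \<open>Positive matrices\<close>

lemma pos_semidef_square:
  assumes "hermitian S"
  shows "pos_semidef (S ** S)"
proof -
  have "0 \<le> Re (cdot v ((S ** S) *v v))" for v
  proof -
    have "cdot v ((S ** S) *v v) = cdot (S *v v) (S *v v)"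
      using assms by (simp add: hermitian_def cdot_adj[of v S] flip: matrix_vector_mul_assoc)
    also have "Re \<dots> \<ge> 0"
      by (simp add: cdot_def sum_nonneg)
    finally show ?thesis .
  qed
  then show ?thesis
    using assms by (simp add: pos_semidef_def hermitian_def adj_mult)
qed

lemma pos_semidef_unitary_diag:
  assumes "unitary U" "\<And>i. 0 \<le> d i"
  shows "pos_semidef (U ** diag (\<lambda>i. of_real (d i)) ** adj U)"
proof -
  let ?S = "U ** diag (\<lambda>i. of_real (sqrt (d i))) ** adj U"
  have "?S ** ?S = U ** diag (\<lambda>i. of_real (d i)) ** adj U"
    using assms by (simp add: unitary_conj_mult diag_mult flip: of_real_mult)
  then show ?thesis
    using pos_semidef_square[OF hermitian_conj_diag] by metis
qed

section \<open>The spectral fidelity of commuting and of pure states\<close>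

text \<open>All powers are computed in the common eigenbasis, where the spectral mean has the entries
  \<open>sqrt (s i / r i)\<close>.\<close>

lemma spec_fidelity_commuting:
  fixes U :: "complex^'n^'n"
  assumes U: "unitary U" and r: "\<And>i. 0 < r i" and s: "\<And>i. 0 < s i"
  shows "spec_fidelity t (U ** diag (\<lambda>i. of_real (r i)) ** adj U)
           (U ** diag (\<lambda>i. of_real (s i)) ** adj U) = (\<Sum>i\<in>UNIV. r i powr (1 - t) * s i powr t)"
proof -
  have scalar: "r i powr (-1/2) * (r i powr (1/2) * s i * r i powr (1/2)) powr (1/2) * r i powr (-1/2)
      = r i powr (-1/2) * s i powr (1/2)" for i
  proof -
    have "r i powr (1/2) * s i * r i powr (1/2) = r i * s i"
      using r[of i] by (simp add: powr_half_sqrt)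
    then have "(r i powr (1/2) * s i * r i powr (1/2)) powr (1/2) = r i powr (1/2) * s i powr (1/2)"
      using r[of i] s[of i] by (simp only: powr_mult less_imp_le)
    moreover have "r i powr (1/2) * r i powr (-1/2) = 1"
      using r[of i] by (simp flip: powr_add)
    ultimately show ?thesis
      by (simp add: mult_ac)
  qed
  have "spec_mean (U ** diag (\<lambda>i. of_real (r i)) ** adj U) (U ** diag (\<lambda>i. of_real (s i)) ** adj U)
      = U ** diag (\<lambda>i. of_real (r i powr (-1/2) * s i powr (1/2))) ** adj U"
    unfolding spec_mean_def mpow_eq[OF U refl] unitary_conj_mult[OF U] diag_mult
      of_real_mult[symmetric] scalar ..
  moreover have "r i * (r i powr (-1/2) * s i powr (1/2)) powr (2 * t)
      = r i powr (1 - t) * s i powr t" for i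
  proof -
    have "(r i powr (-1/2) * s i powr (1/2)) powr (2 * t) = r i powr (- t) * s i powr t"
      by (subst powr_mult) (simp_all add: powr_powr)
    then show ?thesis
      using r[of i] by (simp add: powr_diff powr_minus divide_simps)
  qed
  ultimately show ?thesis
    unfolding spec_fidelity_def
    by (simp add: mpow_eq[OF U refl] unitary_conj_mult[OF U] diag_mult trace_unitary_conj[OF U]
        flip: of_real_mult) (simp add: trace_def diag_def)
qed

text \<open>The eigenvalues of a projection are 0 and 1, and the power function fixes both for every
  exponent, the negative ones included, because powers are taken on the support.\<close>

lemma mpow_scaled_projection:
  fixes P :: "complex^2^2"
  assumes "hermitian P" "P ** P = P" "0 \<le> c"
  shows "mpow (c *\<^sub>R P) r = (c powr r) *\<^sub>R P"
proof -
  obtain U and d :: "2 \<Rightarrow> real"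
    where U: "unitary U" and P: "P = U ** diag (\<lambda>i. of_real (d i)) ** adj U"
    using assms(1) hermitian_diag by metis
  have "adj U ** (P ** P) ** U = adj U ** P ** U"
    using assms(2) by simp
  then have "diag (\<lambda>i. of_real (d i * d i)) = diag (\<lambda>i. complex_of_real (d i))"
    by (simp only: P unitary_conj_mult[OF U] unitary_conj_cancel[OF U] diag_mult of_real_mult)
  then have "diag (\<lambda>i. complex_of_real (d i * d i)) $ i $ i
      = diag (\<lambda>i. complex_of_real (d i)) $ i $ i" for i
    by simp
  then have "d i * d i = d i" for i
    unfolding diag_def by (simp flip: of_real_mult del: mult_cancel_right1 mult_cancel_right2)
  then have d: "d i = 0 \<or> d i = 1" for i
    unfolding mult_cancel_right2 by blast
  have scale: "c *\<^sub>R P = U ** diag (\<lambda>i. of_real (c * d i)) ** adj U" for c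
    unfolding P scaleR_diag[symmetric] matrix_mult_scaleR_left matrix_mult_scaleR_right ..
  have "(c * d i) powr r = c powr r * d i" for i
    using d[of i] by auto
  then show ?thesis
    unfolding scale[of c] scale[of "c powr r"] mpow_eq[OF U refl] by simp
qed

text \<open>Every power of a pure state \<open>P\<close> is \<open>P\<close>, so the spectral mean collapses to the multiple
  \<open>sqrt l\<close> of \<open>P\<close>.\<close>

lemma spec_fidelity_pure_left:
  fixes P \<sigma> :: "complex^2^2"
  assumes P: "hermitian P" "P ** P = P" "trace P = 1"
    and \<sigma>: "P ** \<sigma> ** P = l *\<^sub>R P" and "0 < l"
  shows "spec_fidelity t P \<sigma> = l powr t"
proof -
  have [simp]: "mpow P r = P" for r
    using mpow_scaled_projection[OF P(1,2), of 1 r] by simp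
  have "spec_mean P \<sigma> = (l powr (1/2)) *\<^sub>R P"
    using \<open>0 < l\<close>
    by (simp add: spec_mean_def \<sigma> mpow_scaled_projection P matrix_mult_scaleR_left
        matrix_mult_scaleR_right)
  then show ?thesis
    by (simp add: spec_fidelity_def mpow_scaled_projection P matrix_mult_scaleR_right trace_scaleR
        powr_powr)
qed

text \<open>With \<open>R\<close> the square root of \<open>\<rho>\<close>, the matrix \<open>R ** P ** R\<close> has rank one and eigenvalue \<open>l\<close>.
  Its square root is therefore a multiple of itself, and the outer factors \<open>R\<close> are then cancelled by
  the inverse square roots of \<open>\<rho>\<close>. The spectral mean is \<open>P\<close> divided by \<open>sqrt l\<close>.\<close>

lemma spec_fidelity_pure_right:
  fixes P :: "complex^2^2"
  assumes P: "hermitian P" "P ** P = P" "trace P = 1"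
    and U: "unitary U" and \<rho>: "\<rho> = U ** diag (\<lambda>i. of_real (d i)) ** adj U"
    and d: "\<And>i. 0 < d i"
    and l: "P ** \<rho> ** P = l *\<^sub>R P" and "0 < l"
  shows "spec_fidelity t \<rho> P = l powr (1 - t)"
proof -
  define R where "R = mpow \<rho> (1/2)"
  define R' where "R' = mpow \<rho> (-1/2)"
  have UU: "U ** mat 1 ** adj U = mat 1"
    using U by (simp add: unitary_def)
  have one: "diag (\<lambda>i. 1) = (mat 1 :: complex^2^2)"
    by (simp add: diag_def mat_def)
  have inv: "R' ** R = mat 1" "R ** R' = mat 1" and sq: "R ** R = \<rho>"
    unfolding R_def R'_def mpow_eq[OF U \<rho>] unitary_conj_mult[OF U] diag_mult of_real_mult[symmetric]
      powr_add[symmetric]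
    using d UU by (simp_all add: one \<rho> less_imp_le less_imp_neq[symmetric])
  have R: "hermitian R"
    unfolding R_def \<rho> by (intro hermitian_mpow hermitian_conj_diag)
  define Q where "Q = (1 / l) *\<^sub>R (R ** P ** R)"
  have "hermitian Q"
    using hermitian_sandwich[OF R P(1)] by (simp add: Q_def hermitian_def adj_scaleR)
  have "(R ** P ** R) ** (R ** P ** R) = R ** (P ** (R ** R) ** P) ** R"
    by (simp add: matrix_mul_assoc)
  then have "Q ** Q = Q"
    using \<open>0 < l\<close> by (simp add: Q_def sq l matrix_mult_scaleR_left matrix_mult_scaleR_right)
  have "R ** P ** R = l *\<^sub>R Q"
    using \<open>0 < l\<close> by (simp add: Q_def)
  then have "mpow (R ** P ** R) (1/2) = (l powr (1/2)) *\<^sub>R Q"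
    using \<open>0 < l\<close> \<open>hermitian Q\<close> \<open>Q ** Q = Q\<close> by (simp add: mpow_scaled_projection)
  also have "\<dots> = (l powr (-1/2)) *\<^sub>R (R ** P ** R)"
    using \<open>0 < l\<close> by (simp add: Q_def powr_minus powr_half_sqrt field_simps)
  finally have "spec_mean \<rho> P = (l powr (-1/2)) *\<^sub>R (R' ** (R ** P ** R) ** R')"
    by (simp add: spec_mean_def R_def R'_def matrix_mult_scaleR_left matrix_mult_scaleR_right)
  also have "R' ** (R ** P ** R) ** R' = (R' ** R) ** P ** (R ** R')"
    by (simp add: matrix_mul_assoc)
  finally have "mpow (spec_mean \<rho> P) (2 * t) = (l powr (- t)) *\<^sub>R P"
    by (simp add: inv mpow_scaled_projection P powr_powr)
  moreover have "trace (\<rho> ** P) = of_real l"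
  proof -
    have "trace (\<rho> ** P) = trace (\<rho> ** P ** P)"
      using P(2) by (simp flip: matrix_mul_assoc)
    also have "\<dots> = trace (P ** \<rho> ** P)"
      using trace_mul_sym[of "\<rho> ** P" P] by (simp add: matrix_mul_assoc)
    finally show ?thesis
      by (simp add: l trace_scaleR P of_real_def)
  qed
  ultimately show ?thesis
    using \<open>0 < l\<close>
    by (simp add: spec_fidelity_def matrix_mult_scaleR_right trace_scaleR powr_diff powr_minus
        divide_simps)
qed

section \<open>Pinching\<close>

lemma unitary_basis_matrix:
  assumes "orthonormal_basis B"
  shows "unitary (basis_matrix B)"
proof -
  have "adj (basis_matrix B) ** basis_matrix B = mat 1"
    using assms
    by (simp add: orthonormal_basis_def cdot_def basis_matrix_def adj_def mat_def
        matrix_matrix_mult_def vec_eq_iff)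
  then show ?thesis
    by (simp add: unitary_def matrix_left_right_inverse)
qed

lemma in_basis_conj:
  assumes "orthonormal_basis B"
  shows "in_basis B (basis_matrix B ** M ** adj (basis_matrix B)) = M"
  using unitary_basis_matrix[OF assms] by (simp add: in_basis_def unitary_conj_cancel)

lemma pinching_conj:
  assumes "orthonormal_basis B"
  shows "pinching B (basis_matrix B ** M ** adj (basis_matrix B)) =
    basis_matrix B ** diag (\<lambda>i. M $ i $ i) ** adj (basis_matrix B)"
  by (simp add: pinching_def in_basis_conj[OF assms])

section \<open>States whose fidelity decreases under pinching\<close>

text \<open>At \<open>x = 0\<close> the inequality reads \<open>p powr (1 - m) < p powr m\<close>, which holds since \<open>p < 1\<close> and
  \<open>m < 1 - m\<close>. Both sides are right-continuous at 0, the term \<open>x powr m\<close> because \<open>m\<close> is positive.\<close>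

lemma ex_mixing_weight:
  fixes p m :: real
  assumes "0 < p" "p < 1" "0 < m" "m < 1/2"
  shows "\<exists>x. 0 < x \<and> x < 1 \<and>
    p powr (1 - m) * (1 - x) powr m + (1 - p) powr (1 - m) * x powr m
      < (p * (1 - x) + (1 - p) * x) powr m"
proof -
  let ?f = "\<lambda>x. (p * (1 - x) + (1 - p) * x) powr m
    - (p powr (1 - m) * (1 - x) powr m + (1 - p) powr (1 - m) * x powr m)"
  have "(?f \<longlongrightarrow> p powr m - p powr (1 - m)) (at_right 0)"
  proof -
    have "((\<lambda>x::real. x powr m) \<longlongrightarrow> 0) (at_right 0)"
      using \<open>0 < m\<close> tendsto_zero_powrI[of "\<lambda>x::real. x" "at_right 0" "\<lambda>_. m" m]
      by (simp add: eventually_at_filter)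
    then show ?thesis
      using assms by (auto intro!: tendsto_eq_intros simp: eventually_at_filter)
  qed
  moreover have "0 < p powr m - p powr (1 - m)"
    using assms powr_less_mono'[of p "m" "1 - m"] by simp
  ultimately have "eventually (\<lambda>x. 0 < ?f x) (at_right 0)"
    by (rule order_tendstoD)
  moreover have "eventually (\<lambda>x::real. x \<in> {0<..<1}) (at_right 0)"
    by (rule eventually_at_right_real) simp
  ultimately have "eventually (\<lambda>x. 0 < ?f x \<and> x \<in> {0<..<1}) (at_right 0)"
    by (rule eventually_conj)
  then obtain x where "0 < ?f x \<and> x \<in> {0<..<1}"
    using eventually_happens trivial_limit_at_right_real by blast
  then show ?thesis
    by (intro exI[of _ x]) auto
qed

text \<open>The same pair of a pure state \<open>P\<close> and a diagonal state \<open>D\<close> serves both ranges of \<open>t\<close>, with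
  \<open>P\<close> as first argument for \<open>t < 1/2\<close> and as second argument for \<open>t > 1/2\<close>. In terms of
  \<open>m = min t (1 - t)\<close> the inequality to be shown is the same in both cases.\<close>

lemma ex_pinching_decreases:
  assumes B: "orthonormal_basis B" and t: "0 < t" "t < 1" "t \<noteq> 1/2" and "0 < \<epsilon>"
  shows "\<exists>\<rho> \<sigma>. qubit_state \<rho> \<and> qubit_state \<sigma> \<and>
    spec_fidelity t (pinching B \<rho>) (pinching B \<sigma>) < spec_fidelity t \<rho> \<sigma> \<and>
    (\<forall>i j. i \<noteq> j \<longrightarrow> cmod (in_basis B \<rho> $ i $ j) < \<epsilon> \<and> cmod (in_basis B \<sigma> $ i $ j) < \<epsilon>)"
proof -
  define m where "m = min t (1 - t)"
  have m: "0 < m" "m < 1/2" using t by (auto simp: m_def min_def)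
  \<comment> \<open>The coherence of \<open>P\<close> will be \<open>sqrt (p * q)\<close>, which is less than \<open>sqrt q\<close>.\<close>
  define q where "q = min (1/2) (\<epsilon>\<^sup>2)"
  define p where "p = 1 - q"
  have q: "0 < q" "q < 1" "q \<le> \<epsilon>\<^sup>2" using \<open>0 < \<epsilon>\<close> by (auto simp: q_def)
  have p: "0 < p" "p < 1" using q by (auto simp: p_def)
  obtain x where x: "0 < x" "x < 1" and ineq:
    "p powr (1 - m) * (1 - x) powr m + q powr (1 - m) * x powr m < (p * (1 - x) + q * x) powr m"
    using ex_mixing_weight[OF p m] by (auto simp: p_def)
  define U where "U = basis_matrix B"
  have U: "unitary U" unfolding U_def by (rule unitary_basis_matrix[OF B])
  \<comment> \<open>\<open>M\<close> and \<open>diag d\<close> are the two states written in the basis \<open>B\<close>; \<open>M\<close> projects onto the unit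
    vector with entries \<open>sqrt (w i)\<close>.\<close>
  define w :: "2 \<Rightarrow> real" where "w i = (if i = 1 then p else q)" for i
  define d :: "2 \<Rightarrow> real" where "d i = (if i = 1 then 1 - x else x)" for i
  define M :: "complex^2^2" where "M = (\<chi> i j. of_real (sqrt (w i) * sqrt (w j)))"
  define P where "P = U ** M ** adj U"
  define D where "D = U ** diag (\<lambda>i. of_real (d i)) ** adj U"
  define l where "l = p * (1 - x) + q * x"
  have w: "0 < w i" and d: "0 < d i" for i
    using p q x by (auto simp: w_def d_def)
  have "l > 0" using p q x by (simp add: l_def add_pos_pos)
  have M_sandwich: "M ** diag (\<lambda>i. of_real (e i)) ** M = (w 1 * e 1 + w 2 * e 2) *\<^sub>R M" for e
  proof -
    have entry: "M $ i $ k * (of_real (e k) * M $ k $ j) = of_real (w k * e k) * M $ i $ j" for i j k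
    proof -
      have "sqrt (w i) * sqrt (w k) * (e k * (sqrt (w k) * sqrt (w j)))
          = (sqrt (w k) * sqrt (w k)) * e k * (sqrt (w i) * sqrt (w j))"
        by (simp only: mult_ac)
      also have "sqrt (w k) * sqrt (w k) = w k"
        using w[of k] by simp
      finally show ?thesis
        by (simp add: M_def flip: of_real_mult)
    qed
    have "(M ** (diag (\<lambda>i. of_real (e i)) ** M)) $ i $ j
        = ((w 1 * e 1 + w 2 * e 2) *\<^sub>R M) $ i $ j" for i j
      by (simp add: matrix_matrix_mult_def[of M] diag_mult_left entry sum_2 distrib_right
          scaleR_conv_of_real[where 'a = complex] del: of_real_mult)
    then show ?thesis
      by (simp add: vec_eq_iff flip: matrix_mul_assoc)
  qed
  have M_diag: "M $ i $ i = of_real (w i)" for i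
    using w[of i] by (simp add: M_def flip: of_real_mult)
  have "M ** M = M"
    using M_sandwich[of "\<lambda>_. 1"] p_def by (simp add: diag_def w_def flip: mat_def)
  have "adj M = M"
    by (simp add: M_def adj_def vec_eq_iff mult.commute)
  have P: "hermitian P" "P ** P = P" "trace P = 1"
  proof -
    show "hermitian P"
      using \<open>adj M = M\<close> by (simp add: P_def hermitian_def adj_mult matrix_mul_assoc)
    show "P ** P = P"
      by (simp add: P_def unitary_conj_mult[OF U] \<open>M ** M = M\<close>)
    have "w 1 + w 2 = 1" by (simp add: w_def p_def)
    then show "trace P = 1"
      unfolding P_def trace_unitary_conj[OF U]
      by (simp add: trace_def sum_2 M_diag flip: of_real_add)
  qed
  have PDP: "P ** D ** P = l *\<^sub>R P"
    unfolding P_def D_def unitary_conj_mult[OF U] M_sandwich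
    by (simp add: matrix_mult_scaleR_left matrix_mult_scaleR_right w_def d_def l_def)
  have states: "qubit_state P" "qubit_state D"
  proof -
    show "qubit_state P"
      using pos_semidef_square[OF P(1)] P by (simp add: qubit_state_def)
    show "qubit_state D"
      using pos_semidef_unitary_diag[OF U, of d] d
      by (simp add: qubit_state_def D_def less_imp_le trace_unitary_conj[OF U])
        (simp add: trace_def diag_def sum_2 d_def)
  qed
  have off: "cmod (in_basis B P $ i $ j) < \<epsilon> \<and> cmod (in_basis B D $ i $ j) < \<epsilon>" if "i \<noteq> j" for i j
  proof -
    have "i = 1 \<and> j = 2 \<or> i = 2 \<and> j = 1"
      using that exhaust_2[of i] exhaust_2[of j] by auto
    then have "cmod (M $ i $ j) = sqrt (p * q)"
      using p q by (auto simp: M_def w_def real_sqrt_mult norm_mult mult.commute)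
    also have "\<dots> < sqrt (\<epsilon>\<^sup>2)"
    proof (rule real_sqrt_less_mono)
      have "p * q < 1 * q" using p q by (intro mult_strict_right_mono)
      then show "p * q < \<epsilon>\<^sup>2" using q(3) by linarith
    qed
    finally show ?thesis
      using that \<open>0 < \<epsilon>\<close> by (simp add: P_def D_def U_def in_basis_conj[OF B]) (simp add: diag_def)
  qed
  have pinch: "pinching B P = U ** diag (\<lambda>i. of_real (w i)) ** adj U" "pinching B D = D"
  proof -
    show "pinching B P = U ** diag (\<lambda>i. of_real (w i)) ** adj U"
      by (simp add: P_def U_def pinching_conj[OF B] M_diag)
    show "pinching B D = D"
      unfolding D_def U_def pinching_conj[OF B] by (simp add: diag_def)
  qed
  show ?thesis
  proof (cases "t < 1/2")
    case True
    then have "m = t" by (simp add: m_def)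
    have "spec_fidelity t (pinching B P) (pinching B D)
        = (\<Sum>i\<in>UNIV. w i powr (1 - t) * d i powr t)"
      unfolding pinch unfolding D_def by (intro spec_fidelity_commuting U w d)
    then have "spec_fidelity t (pinching B P) (pinching B D) < spec_fidelity t P D"
      using ineq spec_fidelity_pure_left[OF P PDP \<open>0 < l\<close>]
      by (simp add: sum_2 w_def d_def l_def \<open>m = t\<close>)
    then show ?thesis using states off by blast
  next
    case False
    then have "m = 1 - t" using t by (simp add: m_def)
    have "spec_fidelity t (pinching B D) (pinching B P)
        = (\<Sum>i\<in>UNIV. d i powr (1 - t) * w i powr t)"
      unfolding pinch unfolding D_def by (intro spec_fidelity_commuting U w d)
    moreover have "spec_fidelity t D P = l powr (1 - t)"
      by (rule spec_fidelity_pure_right[OF P U D_def d PDP \<open>0 < l\<close>])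
    ultimately have "spec_fidelity t (pinching B D) (pinching B P) < spec_fidelity t D P"
      using ineq by (simp add: sum_2 w_def d_def l_def \<open>m = 1 - t\<close> mult.commute)
    then show ?thesis using states off by blast
  qed
qed

theorem theorem5p4:
  fixes B :: "2 \<Rightarrow> complex^2" and t :: real
  assumes "orthonormal_basis B"
    and "t \<in> {0<..<1} - {1/2}"
  shows "(\<exists>\<rho> \<sigma>. qubit_state \<rho> \<and> qubit_state \<sigma> \<and>
             spec_fidelity t (pinching B \<rho>) (pinching B \<sigma>) < spec_fidelity t \<rho> \<sigma>) \<and>
         (\<forall>\<epsilon>>0. \<exists>\<rho> \<sigma>. qubit_state \<rho> \<and> qubit_state \<sigma> \<and>
             spec_fidelity t (pinching B \<rho>) (pinching B \<sigma>) < spec_fidelity t \<rho> \<sigma> \<and>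
             (\<forall>i j. i \<noteq> j \<longrightarrow>
                cmod (in_basis B \<rho> $ i $ j) < \<epsilon> \<and> cmod (in_basis B \<sigma> $ i $ j) < \<epsilon>))"
proof -
  have ex: "\<exists>\<rho> \<sigma>. qubit_state \<rho> \<and> qubit_state \<sigma> \<and>
      spec_fidelity t (pinching B \<rho>) (pinching B \<sigma>) < spec_fidelity t \<rho> \<sigma> \<and>
      (\<forall>i j. i \<noteq> j \<longrightarrow> cmod (in_basis B \<rho> $ i $ j) < \<epsilon> \<and> cmod (in_basis B \<sigma> $ i $ j) < \<epsilon>)"
    if "0 < \<epsilon>" for \<epsilon>
    using ex_pinching_decreases[OF assms(1) _ _ _ that] assms(2) by auto
  show ?thesis
  proof (intro conjI allI impI)
    show "\<exists>\<rho> \<sigma>. qubit_state \<rho> \<and> qubit_state \<sigma> \<and>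
        spec_fidelity t (pinching B \<rho>) (pinching B \<sigma>) < spec_fidelity t \<rho> \<sigma>"
      using ex[OF zero_less_one] by (elim exE conjE) (intro exI conjI)
  qed (rule ex)
qed

end
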